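(* Let $P=\{x\in\mathbb{R}^d : Ax\preccurlyeq b\}$ be a bounded convex $d$-polytope in $\mathbb{R}^d$ with $m$ facets, where $A\in\mathbb{R}^{m\times d}$ is the matrix whose rows $a_1^\top,\dots,a_m^\top$ are the outer unit normals to the $m$ facets of $P$, and $b\in\mathbb{R}^m$ is the corresponding vector of offsets from the origin. Let $\delta(P)$ be the degeneracy ratio of $P$ and let $\sigma_{\min}(A)$ be the smallest singular value of $A$. Then $\delta(P)<\sigma_{\min}(A)$.
   Context: A $d$-polytope in $\mathbb{R}^d$ is a full-dimensional polytope. For vectors, $Ax\preccurlyeq b$ means $a_i^\top x\le b_i$ for all $i=1,\dots,m$. The rows of $A$ satisfy $|a_i|_2=1$, where $|\cdot|_2$ is the Euclidean norm, and the $i$-th facet of $P$ lies in the hyperplane $\{x : a_i^\top x=b_i\}$. The singular values of $A$ are $\sigma_1\ge\sigma_2\ge\cdots\ge\sigma_d=:\sigma_{\min}(A)$ (note $m\ge d+1$), i.e. $\sigma_{\min}(A)$ is the square root of the smallest eigenvalue of $A^\top A$. The inner radius of $P$ is $\mathrm{inrad}(P):=\sup\{r>0 : B(x_c,r)\subset P \text{ for some } x_c\in P\}$, where $B(z,r)$ is the open Euclidean ball of radius $r$ centred at $z$. The diameter of $P$ is $\mathrm{diam}(P):=\sup\{|x-y|_2 : x,y\in P\}$. The degeneracy ratio of $P$ is $\delta(P):=\mathrm{inrad}(P)/\mathrm{diam}(P)$. *)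

theory Defs
  imports "HOL-Analysis.Analysis"
begin

definition eigenvalues :: "real^'n^'n \<Rightarrow> real set" where
  "eigenvalues M = {l. \<exists>v. v \<noteq> 0 \<and> M *v v = l *\<^sub>R v}"

(* For at least as many rows as columns, these are the numbers occurring among
   sigma_1 >= ... >= sigma_d (multiplicities dropped): the positive semidefinite d x d matrix
   is taken on the domain side, so sigma_d = 0 is included whenever A has a kernel. *)
definition singular_values :: "real^'d^'m \<Rightarrow> real set" where
  "singular_values A = sqrt ` eigenvalues (transpose A ** A)"

(* Min is meaningful: the set is finite and, by the spectral theorem, nonempty. *)
definition min_singular_value :: "real^'d^'m \<Rightarrow> real" where
  "min_singular_value A = Min (singular_values A)"

definition inradius :: "'a::euclidean_space set \<Rightarrow> real" where
  "inradius P = Sup {r. r > 0 \<and> (\<exists>c\<in>P. ball c r \<subseteq> P)}"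

definition degeneracy_ratio :: "'a::euclidean_space set \<Rightarrow> real" where
  "degeneracy_ratio P = inradius P / diameter P"

(* The order on vectors is the componentwise one, so {x. A *v x <= b} is the intersection of the
   halfspaces a_i . x <= b_i with a_i = row i A; a unit a_i is then automatically an outer normal
   of the face P \<inter> {x. a_i . x = b_i}. The bijection says that this indexes the facets
   of P by the rows of A, each facet exactly once (so P has CARD('m) facets). *)
definition facet_description :: "real^'d^'m \<Rightarrow> real^'m \<Rightarrow> (real^'d) set \<Rightarrow> bool" where
  "facet_description A b P \<longleftrightarrow>
     P = {x. A *v x \<le> b} \<and>
     (\<forall>i. norm (row i A) = 1) \<and>
     bij_betw (\<lambda>i. P \<inter> {x. row i A \<bullet> x = b $ i}) UNIV {F. F facet_of P}"

end

theory Submission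
  imports Defs
begin

text \<open>Let $v$ be a unit eigenvector of $A^T A$ belonging to the least singular value $\sigma$, so
  that $|a_i \cdot v| \le |A v| = \sigma$ for every row. If the ball of radius $r$ about $c$ lies in
  $P$, then $b_i - a_i \cdot c \ge r$ because the rows are unit vectors, and hence $P$ contains the
  whole chord from $c - t v$ to $c + t v$ as long as $t \sigma \le r$. Boundedness forces
  $\sigma > 0$, and $t = r / \sigma$ gives $2 r \le \sigma\,\mathrm{diam}(P)$. Thus even
  $\delta(P) \le \sigma / 2$.\<close>

lemma inner_gram_matrix:
  fixes A :: "real^'d^'m"
  shows "((transpose A ** A) *v x) \<bullet> y = (A *v x) \<bullet> (A *v y)"
  by (metis dot_lmul_matrix inner_commute matrix_vector_mul_assoc transpose_matrix_vector)

text \<open>The Gram matrix is self-adjoint, so eigenvectors of distinct eigenvalues are orthogonal.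
  One chosen eigenvector per eigenvalue thus gives an independent set, which is finite. Needed for
  \<open>Min\<close> in \<open>min_singular_value\<close> to be meaningful.\<close>

lemma finite_eigenvalues_gram_matrix:
  fixes A :: "real^'d^'m"
  shows "finite (eigenvalues (transpose A ** A))" (is "finite (eigenvalues ?M)")
proof -
  define f where "f l = (SOME v. v \<noteq> 0 \<and> ?M *v v = l *\<^sub>R v)" for l
  have f: "f l \<noteq> 0 \<and> ?M *v f l = l *\<^sub>R f l" if "l \<in> eigenvalues ?M" for l
    using that someI_ex[of "\<lambda>v. v \<noteq> 0 \<and> ?M *v v = l *\<^sub>R v"]
    unfolding f_def eigenvalues_def by simp
  have orth: "f k \<bullet> f l = 0" if "k \<in> eigenvalues ?M" "l \<in> eigenvalues ?M" "k \<noteq> l" for k l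
  proof -
    have "(?M *v f k) \<bullet> f l = (?M *v f l) \<bullet> f k"
      unfolding inner_gram_matrix by (rule inner_commute)
    then have "(k - l) * (f k \<bullet> f l) = 0"
      using f that by (simp add: inner_commute algebra_simps)
    with that show ?thesis by simp
  qed
  \<comment> \<open>A vector chosen for two distinct eigenvalues would be orthogonal to itself,
    hence zero.\<close>
  have "inj_on f (eigenvalues ?M)"
    by (rule inj_onI) (metis f inner_eq_zero_iff orth)
  moreover have "finite (f ` eigenvalues ?M)"
  proof -
    have "pairwise orthogonal (f ` eigenvalues ?M)"
      using orth by (auto simp: pairwise_def orthogonal_def)
    moreover have "0 \<notin> f ` eigenvalues ?M"
      using f by auto
    ultimately show ?thesis
      using pairwise_orthogonal_independent independent_imp_finite by blast
  qed
  ultimately show ?thesis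
    using finite_image_iff by blast
qed

text \<open>A minimiser \<open>u\<close> of \<open>norm (A *v x)\<close> on the unit sphere is an eigenvector: the quadratic form
  \<open>f\<close> below is nonnegative and vanishes at \<open>u\<close>, so its gradient \<open>2 * w\<close> there must be zero.\<close>

lemma eigenvalues_gram_matrix_nonempty:
  fixes A :: "real^'d^'m"
  shows "eigenvalues (transpose A ** A) \<noteq> {}" (is "eigenvalues ?M \<noteq> {}")
proof -
  have "sphere (0::real^'d) 1 \<noteq> {}" by simp
  moreover have "continuous_on (sphere 0 1) (\<lambda>x. norm (A *v x))"
    by (intro continuous_intros linear_continuous_on matrix_vector_mul_bounded_linear)
  ultimately obtain u where u: "norm u = 1"
    and min: "\<And>x. norm x = 1 \<Longrightarrow> norm (A *v u) \<le> norm (A *v x)"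
    using continuous_attains_inf[of "sphere 0 1" "\<lambda>x. norm (A *v x)"] by auto
  define l where "l = (norm (A *v u))\<^sup>2"
  define f where "f x = (A *v x) \<bullet> (A *v x) - l * (x \<bullet> x)" for x
  define w where "w = ?M *v u - l *\<^sub>R u"
  \<comment> \<open>\<open>f\<close> is homogeneous of degree 2, so minimality of \<open>u\<close>
    on the unit sphere carries over to every nonzero \<open>x\<close> by rescaling.\<close>
  have f_nonneg: "f x \<ge> 0" for x
  proof (cases "x = 0")
    case False
    then have "norm (A *v u) \<le> norm (A *v x) / norm x"
      using min[of "x /\<^sub>R norm x"] by (simp add: matrix_vector_mult_scaleR divide_simps)
    then have "norm (A *v u) * norm x \<le> norm (A *v x)"
      using False by (simp add: field_simps)
    then have "(norm (A *v u) * norm x)\<^sup>2 \<le> (norm (A *v x))\<^sup>2"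
      by (simp add: power_mono)
    then show ?thesis
      by (simp add: f_def l_def power_mult_distrib power2_norm_eq_inner)
  qed (simp add: f_def)
  have "f u = 0"
    using u by (simp add: f_def l_def power2_norm_eq_inner norm_eq_1)
  moreover have "f (u - t *\<^sub>R w) = f u - 2 * t * (w \<bullet> w) + t\<^sup>2 * f w" for t
  proof -
    \<comment> \<open>The left side is the bilinear form of \<open>f\<close> at \<open>u\<close> and
      \<open>w\<close>; it yields the coefficient of the linear term in \<open>t\<close>.\<close>
    have "(A *v u) \<bullet> (A *v w) - l * (u \<bullet> w) = w \<bullet> w"
      unfolding inner_gram_matrix[symmetric] by (simp add: w_def inner_diff_left)
    then have "(A *v u) \<bullet> (A *v w) = w \<bullet> w + l * (u \<bullet> w)" by simp
    then show ?thesis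
      by (simp add: f_def matrix_vector_mult_diff_distrib matrix_vector_mult_scaleR
          inner_diff_left inner_diff_right inner_commute power2_eq_square algebra_simps)
  qed
  ultimately have quad: "2 * t * (w \<bullet> w) \<le> t\<^sup>2 * f w" for t
    using f_nonneg[of "u - t *\<^sub>R w"] by simp
  have "w \<bullet> w \<le> 0"
  proof (cases "f w = 0")
    case True
    then show ?thesis using quad[of 1] by simp
  next
    case False
    then have "f w > 0" using f_nonneg[of w] by simp
    \<comment> \<open>This \<open>t\<close> minimises
      \<open>t\<^sup>2 * f w - 2 * t * (w \<bullet> w)\<close>, so nonnegativity is tested where it
      says most.\<close>
    with quad[of "w \<bullet> w / f w"] have "2 * (w \<bullet> w)\<^sup>2 \<le> (w \<bullet> w)\<^sup>2"
      by (simp add: power2_eq_square field_simps)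
    then show ?thesis by simp
  qed
  then have "w = 0"
    by (metis inner_gt_zero_iff linorder_not_le)
  then have "?M *v u = l *\<^sub>R u"
    by (simp add: w_def)
  moreover have "u \<noteq> 0" using u by auto
  ultimately show ?thesis
    unfolding eigenvalues_def by blast
qed

text \<open>The least singular value is some \<open>sqrt l\<close> with \<open>l\<close> an
  eigenvalue of the Gram matrix; pairing the eigenvector equation with \<open>v\<close> gives
  \<open>norm (A *v v) = sqrt l * norm v\<close>, and it remains to normalise
  \<open>v\<close>.\<close>

lemma min_singular_value_attained:
  fixes A :: "real^'d^'m"
  obtains v where "norm v = 1" "norm (A *v v) = min_singular_value A"
proof -
  have "min_singular_value A \<in> singular_values A"
    unfolding min_singular_value_def singular_values_def
    by (intro Min_in) (simp_all add: finite_eigenvalues_gram_matrix eigenvalues_gram_matrix_nonempty)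
  then obtain l v where l: "min_singular_value A = sqrt l" and v: "v \<noteq> 0"
    and eig: "(transpose A ** A) *v v = l *\<^sub>R v"
    unfolding singular_values_def eigenvalues_def by auto
  have "(A *v v) \<bullet> (A *v v) = l * (v \<bullet> v)"
    unfolding inner_gram_matrix[symmetric] eig by simp
  then have "norm (A *v v) = sqrt l * norm v"
    by (simp add: norm_eq_sqrt_inner real_sqrt_mult)
  then have "norm (A *v (v /\<^sub>R norm v)) = min_singular_value A"
    using v l by (simp add: matrix_vector_mult_scaleR)
  moreover have "norm (v /\<^sub>R norm v) = 1" using v by simp
  ultimately show ?thesis using that by blast
qed

text \<open>The point of the ball furthest in direction \<open>a\<close> is
  \<open>c + r *\<^sub>R a\<close>, and \<open>a\<close> is a unit vector.\<close>

lemma halfspace_contains_cball: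
  fixes a :: "'a::real_inner"
  assumes "norm a = 1" "r \<ge> 0" "cball c r \<subseteq> {x. a \<bullet> x \<le> \<beta>}"
  shows "a \<bullet> c + r \<le> \<beta>"
proof -
  have "c + r *\<^sub>R a \<in> cball c r"
    using assms by (simp add: dist_norm)
  then have "a \<bullet> (c + r *\<^sub>R a) \<le> \<beta>"
    using assms by blast
  then show ?thesis
    using assms by (simp add: inner_add_right dot_square_norm)
qed

lemma ball_in_polyhedron_radius_le:
  fixes A :: "real^'d^'m" and b :: "real^'m"
  assumes P: "P = {x. A *v x \<le> b}" "bounded P" and unit: "\<And>i. norm (row i A) = 1"
    and ball: "ball c r \<subseteq> P" and r: "r > 0"
  shows "min_singular_value A > 0" "2 * r \<le> min_singular_value A * diameter P"
proof -
  have mem: "x \<in> P \<longleftrightarrow> (\<forall>i. row i A \<bullet> x \<le> b $ i)" for x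
    by (simp add: P less_eq_vec_def matrix_vector_mul_component row_def)
  have "closed P"
  proof -
    have "P = (\<Inter>i. {x. row i A \<bullet> x \<le> b $ i})" using mem by blast
    then show ?thesis by (simp add: closed_INT closed_halfspace_le)
  qed
  \<comment> \<open>The extreme point used for the slack lies on the boundary sphere, so the closed
    ball is required.\<close>
  then have "cball c r \<subseteq> P"
    using closure_minimal[OF ball] r by simp
  then have slack: "row i A \<bullet> c + r \<le> b $ i" for i
    using unit r by (intro halfspace_contains_cball) (auto simp: mem)
  obtain v where v: "norm v = 1" "norm (A *v v) = min_singular_value A"
    by (rule min_singular_value_attained)
  \<comment> \<open>Each entry of \<open>A *v v\<close> is bounded by its Euclidean norm.\<close>
  have row_v: "\<bar>row i A \<bullet> v\<bar> \<le> min_singular_value A" for i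
    using component_le_norm_cart[of "A *v v" i] v
    by (simp add: matrix_vector_mul_component row_def)
  have chord: "c + t *\<^sub>R v \<in> P" if "\<bar>t\<bar> * min_singular_value A \<le> r" for t
    unfolding mem
  proof
    fix i
    have "t * (row i A \<bullet> v) \<le> \<bar>t\<bar> * \<bar>row i A \<bullet> v\<bar>"
      by (simp add: abs_mult[symmetric])
    also have "\<dots> \<le> \<bar>t\<bar> * min_singular_value A"
      by (simp add: mult_left_mono row_v)
    finally show "row i A \<bullet> (c + t *\<^sub>R v) \<le> b $ i"
      using slack[of i] that by (simp add: inner_add_right)
  qed
  have chord_le: "2 * t \<le> diameter P" if "t \<ge> 0" "t * min_singular_value A \<le> r" for t
  proof -
    have "dist (c + t *\<^sub>R v) (c + (- t) *\<^sub>R v) \<le> diameter P"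
      using that by (intro diameter_bounded_bound P chord) simp_all
    moreover have "dist (c + t *\<^sub>R v) (c + (- t) *\<^sub>R v) = norm ((2 * t) *\<^sub>R v)"
      by (simp add: dist_norm scaleR_2 flip: scaleR_scaleR)
    ultimately show ?thesis using v that by simp
  qed
  show pos: "min_singular_value A > 0"
  proof (rule ccontr)
    assume "\<not> ?thesis"
    with v have "min_singular_value A = 0" by (metis norm_ge_zero order_le_less)
    \<comment> \<open>With a zero singular value every \<open>t \<ge> 0\<close> is admissible;
      \<open>t = diameter P + 1\<close> gives a chord that is too long.\<close>
    then have "2 * (diameter P + 1) \<le> diameter P"
      using r diameter_ge_0[OF P(2)] by (intro chord_le) simp_all
    then show False using diameter_ge_0[OF P(2)] by simp
  qed
  then have "2 * (r / min_singular_value A) \<le> diameter P"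
    using r by (intro chord_le) simp_all
  then show "2 * r \<le> min_singular_value A * diameter P"
    using pos by (simp add: field_simps)
qed

theorem proposition1p1:
  fixes A :: "real^'d^'m" and b :: "real^'m" and P :: "(real^'d) set"
  assumes "polytope P" and "bounded P"
    and "aff_dim P = int CARD('d)"
    and "facet_description A b P"
  shows "degeneracy_ratio P < min_singular_value A"
proof -
  let ?R = "{r. r > 0 \<and> (\<exists>c\<in>P. ball c r \<subseteq> P)}"
  have P: "P = {x. A *v x \<le> b}" and unit: "\<And>i. norm (row i A) = 1"
    using assms by (auto simp: facet_description_def)
  note radius_le = ball_in_polyhedron_radius_le[OF P \<open>bounded P\<close> unit]
  \<comment> \<open>Full dimension makes \<open>P\<close> nonempty and its relative interior the
    interior; a nonempty convex set has nonempty relative interior.\<close>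
  have "interior P \<noteq> {}"
    using assms polytope_imp_convex rel_interior_interior
    by (metis DIM_cart DIM_real aff_dim_eq_full aff_dim_empty aff_dim_negative_iff mult.right_neutral
        of_nat_less_0_iff rel_interior_eq_empty)
  then obtain c r where cr: "r > 0" "ball c r \<subseteq> P"
    by (auto simp: mem_interior)
  then have "?R \<noteq> {}" by (auto intro!: exI[of _ r] bexI[of _ c])
  then have "inradius P \<le> min_singular_value A * diameter P / 2"
    unfolding inradius_def using radius_le(2) by (intro cSup_least) (auto simp: field_simps)
  \<comment> \<open>A positive diameter follows from \<open>0 < 2 * r\<close> and the chord bound;
    it permits dividing by \<open>diameter P\<close> below.\<close>
  moreover have pos: "min_singular_value A > 0" and "diameter P > 0"
    using radius_le[OF cr(2,1)] cr(1)
    by (auto simp: zero_less_mult_iff dest: order_less_le_trans[rotated, of "2 * r" _ 0])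
  ultimately have "degeneracy_ratio P \<le> min_singular_value A / 2"
    by (simp add: degeneracy_ratio_def field_simps)
  also have "\<dots> < min_singular_value A" using pos by simp
  finally show ?thesis .
qed

end
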